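(* A non-trivial pseudo BL-algebra $\mathbf A=(A;\vee,\wedge,\cdot,\rightarrow,\rightsquigarrow,0,1)$ belongs to $\mathcal{MNPBL}$ (i.e. every maximal filter of $\mathbf A$ is normal) if, and only if, it satisfies the following system of inequalities: (i) $\big(\big(\prod_{i=1}^n x_i\big)^-\big)^2\le \big(\prod_{i=1}^n x_{\pi(i)}^2\big)^-$ for every $n\in\mathbb N$, every permutation $\pi$ of $\{1,\dots,n\}$ and all $x_1,\dots,x_n\in A$; (ii) $\big(((x\rightarrow y)^n)^-\big)^2\le ((x\rightsquigarrow y)^{2n})^-$ for every $n\in\mathbb N$ and all $x,y\in A$; (iii) $\big(((x\rightsquigarrow y)^n)^-\big)^2\le ((x\rightarrow y)^{2n})^-$ for every $n\in\mathbb N$ and all $x,y\in A$.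
   Context: A pseudo BL-algebra is an algebra $\mathbf A=(A;\vee,\wedge,\cdot,\rightarrow,\rightsquigarrow,0,1)$ of type $\langle 2,2,2,2,2,0,0\rangle$ such that for all $x,y,z\in A$: $(A;\cdot,1)$ is a (not necessarily commutative) monoid; $(A;\vee,\wedge,0,1)$ is a bounded lattice; $x\cdot y\le z$ iff $x\le y\rightarrow z$ iff $y\le x\rightsquigarrow z$; $(x\rightarrow y)\cdot x=x\wedge y=y\cdot(y\rightsquigarrow x)$ (divisibility); $(x\rightarrow y)\vee(y\rightarrow x)=1=(x\rightsquigarrow y)\vee(y\rightsquigarrow x)$ (prelinearity). One writes $xy$ for $x\cdot y$; $\cdot,\wedge,\vee$ bind more strongly than $\rightarrow,\rightsquigarrow$. Notation: $x^-:=x\rightarrow 0$; $x^0:=1$, $x^1:=x$, $x^{n+1}:=x^n\cdot x$; $\prod_{i=1}^n x_i:=x_1x_2\cdots x_n$ (in this order); $\mathbb N=\{1,2,\dots\}$. A filter of $\mathbf A$ is a non-empty $F\subseteq A$ closed under $\cdot$ and upward closed. A filter is maximal if it is proper ($\neq A$) and is not properly contained in any proper filter. A filter $F$ is normal if for all $x,y\in A$: $x\rightarrow y\in F$ iff $x\rightsquigarrow y\in F$. $\mathbf A$ is trivial if $A=\{1\}$, i.e. $0=1$. $\mathcal{MNPBL}$ is the class of pseudo BL-algebras $\mathbf A$ such that either every maximal filter of $\mathbf A$ is normal or $\mathbf A$ is trivial. *)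

theory Defs
  imports Main "HOL-Combinatorics.Permutations"
begin

text \<open>
  The universe of the algebra is the whole type. The library power satisfies
  \<open>x ^ Suc n = x * x ^ n\<close>, which agrees with \<open>x ^ n * x\<close> in every monoid
  (\<open>power_Suc2\<close>). The bounds of the lattice are \<open>0\<close> and \<open>1\<close>, so that the top
  element is the unit of the monoid; the classes with \<open>bot\<close> and \<open>top\<close> are avoided
  because they would introduce second names for them.
\<close>

class pseudo_bl = lattice + monoid_mult + zero +
  fixes imp1 :: "'a \<Rightarrow> 'a \<Rightarrow> 'a"  (infix "\<^bold>\<rightarrow>" 55)
    and imp2 :: "'a \<Rightarrow> 'a \<Rightarrow> 'a"  (infix "\<^bold>\<leadsto>" 55)
  assumes zero_least: "0 \<le> x"
    and one_greatest: "x \<le> 1"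
    and residuation1: "x * y \<le> z \<longleftrightarrow> x \<le> y \<^bold>\<rightarrow> z"
    and residuation2: "x * y \<le> z \<longleftrightarrow> y \<le> x \<^bold>\<leadsto> z"
    and divisibility1: "(x \<^bold>\<rightarrow> y) * x = inf x y"
    and divisibility2: "y * (y \<^bold>\<leadsto> x) = inf x y"
    and prelinearity1: "sup (x \<^bold>\<rightarrow> y) (y \<^bold>\<rightarrow> x) = 1"
    and prelinearity2: "sup (x \<^bold>\<leadsto> y) (y \<^bold>\<leadsto> x) = 1"

definition neg1 :: "'a::pseudo_bl \<Rightarrow> 'a"  ("_\<^sup>-" [1000] 999)
  where "x\<^sup>- = (x \<^bold>\<rightarrow> 0)"

definition pbl_filter :: "'a::pseudo_bl set \<Rightarrow> bool"
  where "pbl_filter F \<longleftrightarrow> F \<noteq> {} \<and> (\<forall>x\<in>F. \<forall>y\<in>F. x * y \<in> F)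
    \<and> (\<forall>x\<in>F. \<forall>y. x \<le> y \<longrightarrow> y \<in> F)"

definition proper_filter :: "'a::pseudo_bl set \<Rightarrow> bool"
  where "proper_filter F \<longleftrightarrow> pbl_filter F \<and> F \<noteq> UNIV"

definition maximal_filter :: "'a::pseudo_bl set \<Rightarrow> bool"
  where "maximal_filter F \<longleftrightarrow> proper_filter F \<and> \<not> (\<exists>G. proper_filter G \<and> F \<subset> G)"

definition normal_filter :: "'a::pseudo_bl set \<Rightarrow> bool"
  where "normal_filter F \<longleftrightarrow> pbl_filter F \<and>
    (\<forall>x y. x \<^bold>\<rightarrow> y \<in> F \<longleftrightarrow> x \<^bold>\<leadsto> y \<in> F)"

definition trivial_pbl :: "'a::pseudo_bl itself \<Rightarrow> bool"
  where "trivial_pbl A \<longleftrightarrow> (UNIV :: 'a set) = {1}"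

definition MNPBL :: "'a::pseudo_bl itself \<Rightarrow> bool"
  where "MNPBL A \<longleftrightarrow> (\<forall>F :: 'a set. maximal_filter F \<longrightarrow> normal_filter F) \<or> trivial_pbl A"

end

(*
  Assume that all maximal filters are normal and write an inequality of the system as c <= 0.
  If c were nonzero, some prime filter P would avoid the negation of c. Let M be a maximal
  filter above P. As P is prime, a factorization c <= p * q gives a contradiction as soon as
  q^- <= p fails modulo M, so c need only be understood in A/M, although A need not be
  semisimple. There A/M is a simple chain, hence commutative by Hoelder's argument, and the
  squares in the inequalities leave enough room to find p and q.

  Conversely, if x is outside a maximal filter M, then some product of elements of M and copies
  of x is 0. Inequality (i) allows these factors to be sorted, so the negation of a power of x
  lies in M. Inequalities (ii) and (iii) carry this from one residual to the other.
*)
theory Submission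
  imports Defs
begin

section \<open>Arithmetic of pseudo BL-algebras\<close>

context pseudo_bl
begin

lemma mult_right_mono_pbl: "x \<le> y \<Longrightarrow> x * z \<le> y * z"
  by (meson local.dual_order.trans local.order_refl local.residuation1)

lemma mult_left_mono_pbl: "x \<le> y \<Longrightarrow> z * x \<le> z * y"
  by (meson local.dual_order.trans local.order_refl local.residuation2)

lemma mult_mono_pbl: "x \<le> y \<Longrightarrow> z \<le> w \<Longrightarrow> x * z \<le> y * w"
  by (meson local.dual_order.trans mult_left_mono_pbl mult_right_mono_pbl)

lemma mult_le_left: "x * y \<le> x"
  using mult_left_mono_pbl[of y 1 x] one_greatest by simp

lemma mult_le_right: "x * y \<le> y"
  using mult_right_mono_pbl[of x 1 y] one_greatest by simp

lemma imp1_mp: "(x \<^bold>\<rightarrow> y) * x \<le> y"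
  by (simp add: residuation1)

lemma imp2_mp: "x * (x \<^bold>\<leadsto> y) \<le> y"
  by (simp add: residuation2)

lemma one_le_iff: "1 \<le> x \<longleftrightarrow> x = 1"
  using one_greatest order.antisym by blast

lemma imp1_eq_one_iff: "x \<^bold>\<rightarrow> y = 1 \<longleftrightarrow> x \<le> y"
  using residuation1[of 1 x y] one_le_iff by auto

lemma one_imp1: "1 \<^bold>\<rightarrow> x = x"
  by (metis imp1_mp local.mult_1_right local.order.antisym local.order_refl residuation1)

lemma imp1_mult: "(x * y) \<^bold>\<rightarrow> z = x \<^bold>\<rightarrow> (y \<^bold>\<rightarrow> z)"
proof (rule order.antisym)
  show "(x * y) \<^bold>\<rightarrow> z \<le> x \<^bold>\<rightarrow> (y \<^bold>\<rightarrow> z)"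
    using imp1_mp[of "x * y" z] by (simp add: residuation1 [symmetric] mult.assoc)
  have "(x \<^bold>\<rightarrow> (y \<^bold>\<rightarrow> z)) * x * y \<le> z"
    using imp1_mp[of x "y \<^bold>\<rightarrow> z"] by (simp add: residuation1)
  then show "x \<^bold>\<rightarrow> (y \<^bold>\<rightarrow> z) \<le> (x * y) \<^bold>\<rightarrow> z"
    by (simp add: residuation1 [symmetric] mult.assoc)
qed

lemma imp2_mult: "(x * y) \<^bold>\<leadsto> z = y \<^bold>\<leadsto> (x \<^bold>\<leadsto> z)"
proof (rule order.antisym)
  show "(x * y) \<^bold>\<leadsto> z \<le> y \<^bold>\<leadsto> (x \<^bold>\<leadsto> z)"
    using imp2_mp[of "x * y" z] by (simp add: residuation2 [symmetric] mult.assoc)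
  have "x * (y * (y \<^bold>\<leadsto> (x \<^bold>\<leadsto> z))) \<le> z"
    using imp2_mp[of y "x \<^bold>\<leadsto> z"] by (simp add: residuation2)
  then show "y \<^bold>\<leadsto> (x \<^bold>\<leadsto> z) \<le> (x * y) \<^bold>\<leadsto> z"
    by (simp add: residuation2 [symmetric] mult.assoc)
qed

text \<open>Residuation distributes the product over both joins; of the four resulting products, all
  but \<open>x * y\<close> contain a factor \<open>z\<close> and so lie below
  \<open>z\<close>.\<close>

lemma sup_mult_sup_le: "sup x z * sup y z \<le> sup (x * y) z"
proof -
  have "x * y \<le> sup (x * y) z" "x * z \<le> sup (x * y) z"
       "z * y \<le> sup (x * y) z" "z * z \<le> sup (x * y) z"
    using mult_le_left mult_le_right by (auto intro: le_supI2)
  then have "x \<le> y \<^bold>\<rightarrow> sup (x * y) z" "x \<le> z \<^bold>\<rightarrow> sup (x * y) z"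
    "z \<le> y \<^bold>\<rightarrow> sup (x * y) z" "z \<le> z \<^bold>\<rightarrow> sup (x * y) z"
    by (simp_all only: residuation1)
  then have "sup x z * y \<le> sup (x * y) z" "sup x z * z \<le> sup (x * y) z"
    by (simp_all add: residuation1)
  then show ?thesis
    by (simp add: residuation2)
qed

lemma prod_list_squares_le: "prod_list (map (\<lambda>x. x ^ 2) xs) \<le> prod_list xs"
  by (induction xs) (auto simp: power2_eq_square intro!: mult_mono_pbl mult_le_left)

end

lemma le_neg1_iff: "x \<le> y\<^sup>- \<longleftrightarrow> x * y \<le> 0"
  by (simp add: neg1_def residuation1)

lemma neg1_mult_self: "x\<^sup>- * x \<le> 0"
  by (simp add: neg1_def imp1_mp)

section \<open>Filters\<close>

lemma pbl_filterD:
  assumes "pbl_filter F"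
  shows pbl_filter_one: "1 \<in> F"
    and pbl_filter_mult: "x \<in> F \<Longrightarrow> y \<in> F \<Longrightarrow> x * y \<in> F"
    and pbl_filter_up: "x \<in> F \<Longrightarrow> x \<le> y \<Longrightarrow> y \<in> F"
  using assms one_greatest unfolding pbl_filter_def by blast+

lemma pbl_filter_mult_iff:
  assumes "pbl_filter F"
  shows "x * y \<in> F \<longleftrightarrow> x \<in> F \<and> y \<in> F"
  using pbl_filterD[OF assms] mult_le_left mult_le_right by blast

lemma pbl_filter_power:
  assumes "pbl_filter F" "x \<in> F"
  shows "x ^ n \<in> F"
  by (induction n) (auto simp: pbl_filterD assms)

lemma pbl_filter_prod_list_iff:
  assumes "pbl_filter F"
  shows "prod_list xs \<in> F \<longleftrightarrow> set xs \<subseteq> F"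
  by (induction xs) (auto simp: pbl_filter_one[OF assms] pbl_filter_mult_iff[OF assms])

lemma proper_filter_iff: "proper_filter F \<longleftrightarrow> pbl_filter F \<and> 0 \<notin> F"
  unfolding proper_filter_def using pbl_filter_up zero_least by blast

text \<open>One notion serves twice: \<open>d = 0\<close> gives the maximal filters, while
  \<open>d = c\<^sup>-\<close> gives the prime filter needed to prove
  \<open>c \<le> 0\<close>.\<close>

definition maximal_avoiding :: "'a::pseudo_bl \<Rightarrow> 'a set \<Rightarrow> bool"
  where "maximal_avoiding d F \<longleftrightarrow> pbl_filter F \<and> d \<notin> F \<and>
    (\<forall>G. pbl_filter G \<and> F \<subset> G \<longrightarrow> d \<in> G)"

lemma maximal_filter_iff: "maximal_filter F \<longleftrightarrow> maximal_avoiding 0 F"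
  unfolding maximal_filter_def maximal_avoiding_def proper_filter_iff by blast

lemma ex_maximal_avoiding:
  fixes F :: "'a::pseudo_bl set"
  assumes "pbl_filter F" "d \<notin> F"
  obtains Q where "maximal_avoiding d Q" "F \<subseteq> Q"
proof -
  let ?S = "{G. pbl_filter G \<and> F \<subseteq> G \<and> d \<notin> G}"
  have "\<exists>Q\<in>?S. \<forall>X\<in>?S. Q \<subseteq> X \<longrightarrow> X = Q"
  proof (rule subset_Zorn_nonempty)
    show "?S \<noteq> {}" using assms by blast
  next
    fix C assume C: "C \<noteq> {}" "subset.chain ?S C"
    then have "\<exists>Z\<in>C. x \<in> Z \<and> y \<in> Z" if "x \<in> \<Union>C" "y \<in> \<Union>C" for x y
      using that unfolding subset_chain_def by blast
    moreover have sub: "\<And>Z. Z \<in> C \<Longrightarrow> pbl_filter Z \<and> F \<subseteq> Z \<and> d \<notin> Z"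
      using C unfolding subset_chain_def by blast
    ultimately have "x * y \<in> \<Union>C" if "x \<in> \<Union>C" "y \<in> \<Union>C" for x y
      using that by (meson UnionI pbl_filter_mult)
    moreover have "y \<in> \<Union>C" if "x \<in> \<Union>C" "x \<le> y" for x y
      using that sub by (meson UnionE UnionI pbl_filter_up)
    moreover have "F \<subseteq> \<Union>C" "d \<notin> \<Union>C" "F \<noteq> {}"
      using C(1) sub assms pbl_filter_one by blast+
    ultimately show "\<Union>C \<in> ?S"
      unfolding pbl_filter_def by blast
  qed
  then obtain Q where "Q \<in> ?S" and max: "\<forall>X\<in>?S. Q \<subseteq> X \<longrightarrow> X = Q"
    by (rule bexE)
  then have Q: "pbl_filter Q" "F \<subseteq> Q" "d \<notin> Q" by simp_all
  have "d \<in> G" if "pbl_filter G" "Q \<subset> G" for G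
    using that Q(2) bspec[OF max, of G] by blast
  then have "maximal_avoiding d Q"
    using Q(1,3) by (simp add: maximal_avoiding_def)
  then show thesis
    using Q(2) by (rule that)
qed

text \<open>The set \<open>{z. sup z y \<in> F}\<close> is a filter above \<open>F\<close>; this replaces an explicit
  description of the filter generated by \<open>F\<close> and an element.\<close>
lemma maximal_avoiding_prime:
  assumes F: "maximal_avoiding d F" and xy: "sup x y \<in> F"
  shows "x \<in> F \<or> y \<in> F"
proof (rule ccontr)
  have fF: "pbl_filter F" using F by (simp add: maximal_avoiding_def)
  have enlarge: "sup d y \<in> F" if "sup x y \<in> F" "x \<notin> F" for x y
  proof -
    let ?G = "{z. sup z y \<in> F}"
    have "F \<subseteq> ?G"
      using pbl_filter_up[OF fF] by auto
    moreover have "z * w \<in> ?G" if "z \<in> ?G" "w \<in> ?G" for z w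
    proof -
      have "sup z y * sup w y \<in> F" using that pbl_filter_mult[OF fF] by blast
      then have "sup (z * w) y \<in> F" by (rule pbl_filter_up[OF fF _ sup_mult_sup_le])
      then show ?thesis by blast
    qed
    moreover have "w \<in> ?G" if "z \<in> ?G" "z \<le> w" for z w
    proof -
      have "sup z y \<le> sup w y" using that(2) by (simp add: le_supI1)
      then show ?thesis using that(1) pbl_filter_up[OF fF] by blast
    qed
    ultimately have "pbl_filter ?G"
      using pbl_filter_one[OF fF] unfolding pbl_filter_def by blast
    moreover have "F \<subset> ?G" using \<open>F \<subseteq> ?G\<close> that by blast
    ultimately show ?thesis using F unfolding maximal_avoiding_def by blast
  qed
  assume neg: "\<not> (x \<in> F \<or> y \<in> F)"
  \<comment> \<open>The first use of \<open>enlarge\<close> trades \<open>x\<close> for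
    \<open>d\<close>; the second trades \<open>y\<close> for \<open>d\<close>, leaving
    \<open>sup d d = d\<close> in \<open>F\<close>.\<close>
  then have "sup y d \<in> F" using enlarge[OF xy] by (simp add: sup_commute)
  then have "sup d d \<in> F" using enlarge neg by blast
  then show False using F by (simp add: maximal_avoiding_def)
qed

text \<open>By prelinearity a prime \<open>P\<close> inside \<open>M\<close> contains one of the two
  implications between \<open>p\<close> and \<open>q\<^sup>-\<close>. The one outside
  \<open>M\<close> is excluded, and the other equals \<open>(p * q)\<^sup>-\<close>, which lies
  below \<open>c\<^sup>-\<close>.\<close>

lemma eq_zero_by_maximal_filters:
  fixes c :: "'a::pseudo_bl"
  assumes split: "\<And>M. maximal_filter M \<Longrightarrow> \<exists>p q. c \<le> p * q \<and> q\<^sup>- \<^bold>\<rightarrow> p \<notin> M"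
  shows "c \<le> 0"
proof (rule ccontr)
  assume "\<not> c \<le> 0"
  then have "c\<^sup>- \<noteq> 1"
    by (simp add: neg1_def imp1_eq_one_iff)
  moreover have "pbl_filter {1::'a}"
    by (auto simp: pbl_filter_def one_le_iff)
  ultimately obtain P where P: "maximal_avoiding (c\<^sup>-) P"
    using ex_maximal_avoiding by blast
  then have fP: "pbl_filter P" "c\<^sup>- \<notin> P" "0 \<notin> P"
    using pbl_filter_up zero_least unfolding maximal_avoiding_def by blast+
  then obtain M where M: "maximal_filter M" "P \<subseteq> M"
    using ex_maximal_avoiding unfolding maximal_filter_iff by blast
  obtain p q where pq: "c \<le> p * q" "q\<^sup>- \<^bold>\<rightarrow> p \<notin> M"
    using split[OF M(1)] by blast
  have "sup (p \<^bold>\<rightarrow> q\<^sup>-) (q\<^sup>- \<^bold>\<rightarrow> p) \<in> P"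
    using pbl_filter_one[OF fP(1)] by (simp add: prelinearity1)
  then have "(p * q)\<^sup>- \<in> P"
    using maximal_avoiding_prime[OF P] pq(2) M(2) by (auto simp: neg1_def imp1_mult)
  moreover have "(p * q)\<^sup>- \<le> c\<^sup>-"
    using pq(1) mult_left_mono_pbl neg1_mult_self order_trans unfolding le_neg1_iff by blast
  ultimately show False
    using fP pbl_filter_up by blast
qed

section \<open>The quotient by a normal maximal filter\<close>

locale normal_maximal =
  fixes M :: "'a::pseudo_bl set"
  assumes maximal: "maximal_filter M" and normal: "normal_filter M"
begin

lemma fM: "pbl_filter M" and zero_notin: "0 \<notin> M"
  using maximal by (auto simp: maximal_filter_iff maximal_avoiding_def)

lemmas oneM = pbl_filter_one[OF fM]
  and multM = pbl_filter_mult[OF fM]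
  and upM = pbl_filter_up[OF fM]

text \<open>The order of the quotient by \<open>M\<close>, pulled back to a preorder on the algebra,
  so that no quotient type has to be formed.\<close>

definition le :: "'a \<Rightarrow> 'a \<Rightarrow> bool"  (infix "\<preceq>" 50)
  where "x \<preceq> y \<longleftrightarrow> x \<^bold>\<rightarrow> y \<in> M"

text \<open>Normality enters the quotient here: both residuals induce the same preorder, which makes
  the product monotone in its right factor as well.\<close>

lemma le_iff_imp2: "x \<preceq> y \<longleftrightarrow> x \<^bold>\<leadsto> y \<in> M"
  using normal by (simp add: le_def normal_filter_def)

lemma leI: "x \<le> y \<Longrightarrow> x \<preceq> y"
  by (metis imp1_eq_one_iff le_def oneM)

lemma le_trans [trans]: "x \<preceq> y \<Longrightarrow> y \<preceq> z \<Longrightarrow> x \<preceq> z"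
proof -
  assume "x \<preceq> y" "y \<preceq> z"
  then have "(y \<^bold>\<rightarrow> z) * (x \<^bold>\<rightarrow> y) \<in> M" by (simp add: le_def multM)
  moreover have "(y \<^bold>\<rightarrow> z) * ((x \<^bold>\<rightarrow> y) * x) \<le> z"
    by (rule order_trans[OF mult_left_mono_pbl[OF imp1_mp] imp1_mp])
  then have "(y \<^bold>\<rightarrow> z) * (x \<^bold>\<rightarrow> y) \<le> x \<^bold>\<rightarrow> z"
    by (simp add: residuation1 [symmetric] mult.assoc)
  ultimately show ?thesis unfolding le_def by (rule upM)
qed

lemma le_total: "x \<preceq> y \<or> y \<preceq> x"
  using maximal_avoiding_prime[of 0 M "x \<^bold>\<rightarrow> y" "y \<^bold>\<rightarrow> x"] maximal oneM
  by (simp add: le_def prelinearity1 maximal_filter_iff)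

lemma one_le_iff_mem: "1 \<preceq> x \<longleftrightarrow> x \<in> M"
  by (simp add: le_def one_imp1)

lemma le_residuation1: "x * y \<preceq> z \<longleftrightarrow> x \<preceq> y \<^bold>\<rightarrow> z"
  by (simp add: le_def imp1_mult)

lemma le_residuation2: "x * y \<preceq> z \<longleftrightarrow> y \<preceq> x \<^bold>\<leadsto> z"
  by (simp add: le_iff_imp2 imp2_mult)

lemma le_mult_mono: "x \<preceq> y \<Longrightarrow> z \<preceq> w \<Longrightarrow> x * z \<preceq> y * w"
proof -
  assume "x \<preceq> y" "z \<preceq> w"
  have "x \<preceq> z \<^bold>\<rightarrow> y * z"
    by (rule le_trans[OF \<open>x \<preceq> y\<close>]) (simp add: leI residuation1 [symmetric])
  then have "x * z \<preceq> y * z" by (simp only: le_residuation1)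
  moreover have "z \<preceq> y \<^bold>\<leadsto> y * w"
    by (rule le_trans[OF \<open>z \<preceq> w\<close>]) (simp add: leI residuation2 [symmetric])
  then have "y * z \<preceq> y * w" by (simp only: le_residuation2)
  ultimately show ?thesis by (rule le_trans)
qed

text \<open>By divisibility the right side is \<open>inf x y\<close>, which agrees with
  \<open>x\<close> modulo \<open>M\<close>.\<close>

lemma le_divide:
  assumes "x \<preceq> y"
  shows "x \<preceq> y * (y \<^bold>\<leadsto> x)"
proof -
  have "(x \<^bold>\<rightarrow> y) * x \<le> inf x y" by (simp add: divisibility1)
  then have "x \<^bold>\<rightarrow> y \<le> x \<^bold>\<rightarrow> inf x y" by (simp only: residuation1)
  then show ?thesis using assms upM by (auto simp: le_def divisibility2)
qed

section \<open>Simplicity and commutativity of the quotient\<close>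

lemma archimedean:
  assumes "x \<notin> M"
  shows "\<exists>n. x ^ n \<preceq> 0"
proof -
  \<comment> \<open>A filter that contains \<open>M\<close> and \<open>x\<close>; maximality of
    \<open>M\<close> then forces \<open>0\<close> into it.\<close>
  let ?G = "{z. \<exists>n. x ^ n \<preceq> z}"
  have "M \<subseteq> ?G"
    using one_le_iff_mem by (auto intro!: exI[of _ 0])
  moreover have "x ^ 1 \<preceq> x" by (simp add: leI)
  then have "x \<in> ?G" by blast
  moreover have "z * w \<in> ?G" if z: "z \<in> ?G" and w: "w \<in> ?G" for z w
  proof -
    obtain k l where "x ^ k \<preceq> z" "x ^ l \<preceq> w" using z w by blast
    then have "x ^ (k + l) \<preceq> z * w" by (simp add: le_mult_mono power_add)
    then show ?thesis by blast
  qed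
  moreover have "w \<in> ?G" if "z \<in> ?G" "z \<le> w" for z w
    using that(1) le_trans[OF _ leI[OF that(2)]] by blast
  ultimately have "pbl_filter ?G" "M \<subset> ?G"
    using assms unfolding pbl_filter_def by blast+
  then show ?thesis
    using maximal unfolding maximal_filter_iff maximal_avoiding_def by blast
qed

lemma power_bracket:
  assumes "u \<notin> M"
  obtains m where "u ^ Suc m \<preceq> x" "x \<preceq> u ^ m"
proof -
  obtain N where "u ^ N \<preceq> x"
    using archimedean[OF assms] leI zero_least le_trans by blast
  then have *: "u ^ (LEAST k. u ^ k \<preceq> x) \<preceq> x" by (rule LeastI)
  show thesis
  proof (cases "LEAST k. u ^ k \<preceq> x")
    \<comment> \<open>Here \<open>x\<close> is the top of the quotient, and \<open>m = 0\<close>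
      still gives a bracket.\<close>
    case 0
    then have "1 \<preceq> x" using * by simp
    then have "u ^ Suc 0 \<preceq> x" "x \<preceq> u ^ 0"
      using le_trans[OF leI[OF one_greatest]] by (auto intro: leI one_greatest)
    then show thesis by (rule that)
  next
    case (Suc m)
    then have "\<not> u ^ m \<preceq> x" using not_less_Least[of m "\<lambda>k. u ^ k \<preceq> x"] by simp
    then show thesis using that * Suc le_total by metis
  qed
qed

text \<open>In the quotient \<open>t\<close> factors as \<open>s * r\<close> with both factors below
  the top; the larger factor serves as \<open>u\<close>.\<close>

lemma square_root_above:
  assumes "t \<notin> M" "s \<notin> M" "t \<preceq> s" "\<not> s \<preceq> t"
  obtains u where "u \<notin> M" "t \<preceq> u * u"
proof -
  define r where "r = s \<^bold>\<leadsto> t"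
  have "t \<preceq> s * r" using le_divide assms(3) r_def by blast
  have "r \<notin> M" using assms(4) by (simp add: r_def le_iff_imp2)
  from le_total[of r s] show thesis
  proof
    assume "r \<preceq> s"
    then have "s * r \<preceq> s * s" using le_mult_mono leI by blast
    then show thesis using that \<open>t \<preceq> s * r\<close> le_trans assms(2) by blast
  next
    assume "s \<preceq> r"
    then have "s * r \<preceq> r * r" using le_mult_mono leI by blast
    then show thesis using that \<open>t \<preceq> s * r\<close> le_trans \<open>r \<notin> M\<close> by blast
  qed
qed

text \<open>Hoelder's argument. If the quotient has a coatom then every element is a power of it.
  Otherwise a failure \<open>r < 1\<close> of commutativity is exceeded by some \<open>u\<^sup>2\<close> with \<open>u < 1\<close>,
  and enclosing both factors between consecutive powers of \<open>u\<close> bounds the failure by \<open>u\<^sup>2\<close>.\<close>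
lemma le_commute: "x * y \<preceq> y * x"
proof (cases "\<exists>t. t \<notin> M \<and> (\<forall>s. s \<notin> M \<longrightarrow> s \<preceq> t)")
  case True
  then obtain t where t: "t \<notin> M" "\<And>s. s \<notin> M \<Longrightarrow> s \<preceq> t" by blast
  have pow: "\<exists>k. x \<preceq> t ^ k \<and> t ^ k \<preceq> x" for x
  proof -
    obtain m where m: "t ^ Suc m \<preceq> x" "x \<preceq> t ^ m"
      using power_bracket[OF t(1)] by blast
    show ?thesis
    proof (cases "t ^ m \<preceq> x")
      case True
      then show ?thesis using m by blast
    next
      case False
      \<comment> \<open>The residual lies outside \<open>M\<close>, hence below the coatom
        \<open>t\<close>, so \<open>x\<close> drops to the next power of \<open>t\<close>.\<close>
      then have "t ^ m \<^bold>\<leadsto> x \<preceq> t" using t(2) by (simp add: le_iff_imp2)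
      then have "x \<preceq> t ^ m * t"
        using le_mult_mono[OF leI[OF order_refl]] le_trans le_divide[OF m(2)] by blast
      then show ?thesis using m(1) by (metis power_Suc2)
    qed
  qed
  obtain k l where "x \<preceq> t ^ k" "t ^ k \<preceq> x" "y \<preceq> t ^ l" "t ^ l \<preceq> y"
    using pow by blast
  then have "x * y \<preceq> t ^ k * t ^ l" "t ^ l * t ^ k \<preceq> y * x"
    by (simp_all add: le_mult_mono)
  then show ?thesis
    by (metis add.commute le_trans power_add)
next
  case False
  then have dense: "\<exists>s. s \<notin> M \<and> \<not> s \<preceq> t" if "t \<notin> M" for t using that by blast
  show ?thesis
  proof (rule ccontr)
    assume neg: "\<not> ?thesis"
    define r where "r = (x * y) \<^bold>\<leadsto> (y * x)"
    have "r \<notin> M" using neg by (simp add: r_def le_iff_imp2)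
    then obtain s where s: "s \<notin> M" "\<not> s \<preceq> r" using dense by blast
    \<comment> \<open>A second element strictly above \<open>s\<close> is what
      \<open>square_root_above\<close> needs to put a square above \<open>s\<close>.\<close>
    then obtain s' where "s' \<notin> M" "\<not> s' \<preceq> s" using dense by blast
    then obtain u where u: "u \<notin> M" "s \<preceq> u * u"
      using square_root_above[OF s(1)] le_total by blast
    obtain m where m: "u ^ Suc m \<preceq> x" "x \<preceq> u ^ m" using power_bracket[OF u(1)] by blast
    obtain n where n: "u ^ Suc n \<preceq> y" "y \<preceq> u ^ n" using power_bracket[OF u(1)] by blast
    have "x * y * (u * u) \<preceq> u ^ m * u ^ n * (u * u)"
      using m n le_mult_mono leI by blast
    \<comment> \<open>Both sides are \<open>u ^ (m + n + 2)\<close>: the factor \<open>u * u\<close>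
      lowers both upper ends of the brackets to their lower ends.\<close>
    also have "u ^ m * u ^ n * (u * u) = u ^ Suc n * u ^ Suc m"
      by (simp only: power_add [symmetric] power2_eq_square [symmetric])
        (rule arg_cong[of _ _ "\<lambda>k. u ^ k"], simp)
    also have "u ^ Suc n * u ^ Suc m \<preceq> y * x"
      using m n le_mult_mono by blast
    finally have "u * u \<preceq> r" by (simp add: r_def le_residuation2)
    then show False using u(2) s(2) le_trans by blast
  qed
qed

text \<open>The head of \<open>xs\<close> is located inside \<open>ys\<close> and moved past the
  entries before it by \<open>le_commute\<close>.\<close>

lemma prod_list_le_permuted:
  "mset xs = mset ys \<Longrightarrow> prod_list xs \<preceq> prod_list ys"
proof (induction xs arbitrary: ys)
  case Nil
  then show ?case by (simp add: leI)
next
  case (Cons x xs)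
  then have "x \<in> set ys" by (metis list.set_intros(1) mset_eq_setD)
  then obtain us vs where ys: "ys = us @ x # vs" by (meson split_list)
  have "prod_list xs \<preceq> prod_list us * prod_list vs"
    using Cons ys by (metis add_mset_add_mset_same_iff mset.simps(2) mset_append
        prod_list.append union_mset_add_mset_right)
  then have "x * prod_list xs \<preceq> x * prod_list us * prod_list vs"
    by (metis le_mult_mono leI mult.assoc order_refl)
  also have "\<dots> \<preceq> prod_list us * x * prod_list vs"
    using le_commute le_mult_mono leI by blast
  finally show ?case by (simp add: ys mult.assoc)
qed

lemma imp1_le_imp2: "x \<^bold>\<rightarrow> y \<preceq> x \<^bold>\<leadsto> y"
  by (meson imp1_mp le_commute leI le_residuation2 le_trans)

lemma imp2_le_imp1: "x \<^bold>\<leadsto> y \<preceq> x \<^bold>\<rightarrow> y"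
  by (meson imp2_mp le_commute leI le_residuation1 le_trans)

section \<open>Negation in the quotient and the factorizations for the inequalities\<close>

lemma le_power_mono: "x \<preceq> y \<Longrightarrow> x ^ n \<preceq> y ^ n"
  by (induction n) (auto simp: leI le_mult_mono)

text \<open>If \<open>x\<^sup>-\<close> were null, a null power of \<open>x\<close> would make the
  preceding power null too, down to \<open>1 \<preceq> 0\<close>.\<close>

lemma neg1_not_le_zero:
  assumes "x \<notin> M"
  shows "\<not> x\<^sup>- \<preceq> 0"
proof
  assume neg: "x\<^sup>- \<preceq> 0"
  have "x ^ n \<preceq> 0 \<Longrightarrow> False" for n
  proof (induction n)
    case 0
    then show ?case using one_le_iff_mem zero_notin by simp
  next
    case (Suc n)
    then have "x ^ n \<preceq> x\<^sup>-"
      unfolding neg1_def by (metis le_residuation1 power_Suc2)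
    then show ?case using Suc.IH neg le_trans by blast
  qed
  then show False using archimedean[OF assms] by blast
qed

lemma idempotent_cases:
  assumes "x \<preceq> x * x"
  shows "x \<in> M \<or> x \<preceq> 0"
proof -
  have "x \<preceq> x ^ n" for n
  proof (induction n)
    case 0
    then show ?case by (simp add: leI one_greatest)
  next
    case (Suc n)
    then show ?case using assms le_mult_mono[OF leI[OF order_refl]] le_trans
      by (metis power_Suc)
  qed
  then show ?thesis using archimedean le_trans by blast
qed

lemma neg1_not_le:
  assumes "p \<preceq> 0" "q \<notin> M"
  shows "\<not> q\<^sup>- \<preceq> p"
  using neg1_not_le_zero[OF assms(2)] le_trans[OF _ assms(1)] by blast

text \<open>The cases are \<open>a\<close> top, null or strictly between in the quotient. A null
  \<open>a\<close> is left to the hypothesis \<open>null\<close>, since the factorization of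
  \<open>b\<close> must hold in the algebra itself.\<close>

lemma split_neg1_square:
  assumes ba: "b \<preceq> a"
    and null: "a \<preceq> 0 \<Longrightarrow> \<exists>p q. b \<le> p * q \<and> p \<preceq> 0 \<and> q \<notin> M"
  shows "\<exists>p q. (a\<^sup>-) ^ 2 * b \<le> p * q \<and> q\<^sup>- \<^bold>\<rightarrow> p \<notin> M"
proof -
  consider "a \<in> M" | "a \<preceq> 0" | "a \<notin> M" "\<not> a \<preceq> 0" by blast
  then have "\<exists>p q. (a\<^sup>-) ^ 2 * b \<le> p * q \<and> \<not> q\<^sup>- \<preceq> p"
  proof cases
    case 1
    have "a\<^sup>- \<notin> M"
      using 1 multM neg1_mult_self upM zero_notin by blast
    have "a\<^sup>- * 1 \<preceq> a\<^sup>- * a"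
      using 1 le_mult_mono leI one_le_iff_mem by blast
    then have "a\<^sup>- \<preceq> 0"
      using leI[OF neg1_mult_self] le_trans by fastforce
    moreover have "a\<^sup>- * b \<notin> M"
      \<comment> \<open>The square is cut in two: \<open>p\<close> is one copy of
        \<open>a\<^sup>-\<close>, and \<open>q\<close> is the other copy times
        \<open>b\<close>.\<close>
      using \<open>a\<^sup>- \<notin> M\<close> pbl_filter_mult_iff[OF fM] by blast
    ultimately show ?thesis
      using neg1_not_le by (metis mult.assoc order_refl power2_eq_square)
  next
    case 2
    then obtain p q where "b \<le> p * q" "p \<preceq> 0" "q \<notin> M" using null by blast
    then show ?thesis using neg1_not_le mult_le_right order_trans by meson
  next
    case 3
    \<comment> \<open>Now \<open>p\<close> is the whole square and \<open>q\<close> is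
      \<open>b\<close>. Otherwise \<open>a\<^sup>-\<close> would be idempotent in the quotient,
      hence top or null, against the position of \<open>a\<close>.\<close>
    have "\<not> b\<^sup>- \<preceq> (a\<^sup>-) ^ 2"
    proof
      assume *: "b\<^sup>- \<preceq> (a\<^sup>-) ^ 2"
      have "a\<^sup>- * b \<preceq> a\<^sup>- * a" using ba le_mult_mono leI by blast
      then have "a\<^sup>- \<preceq> b\<^sup>-"
        using leI[OF neg1_mult_self] le_trans le_residuation1 neg1_def by metis
      then have "a\<^sup>- \<in> M \<or> a\<^sup>- \<preceq> 0"
        using idempotent_cases * le_trans by (metis power2_eq_square)
      then show False
        using neg1_not_le_zero 3 by (auto simp: neg1_def le_def)
    qed
    then show ?thesis by blast
  qed
  then show ?thesis by (simp add: le_def)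
qed

lemma split_permuted_product:
  assumes "mset xs = mset ys"
  shows "\<exists>p q. ((prod_list xs)\<^sup>-) ^ 2 * prod_list (map (\<lambda>x. x ^ 2) ys) \<le> p * q
    \<and> q\<^sup>- \<^bold>\<rightarrow> p \<notin> M"
proof (rule split_neg1_square)
  show "prod_list (map (\<lambda>x. x ^ 2) ys) \<preceq> prod_list xs"
    using leI[OF prod_list_squares_le] prod_list_le_permuted assms le_trans by metis
next
  assume "prod_list xs \<preceq> 0"
  then have null: "prod_list ys \<preceq> 0"
    using prod_list_le_permuted assms le_trans by metis
  then have "prod_list ys \<notin> M"
    using one_le_iff_mem zero_notin le_trans by blast
  then have "\<exists>y\<in>set ys. y \<notin> M" using pbl_filter_prod_list_iff[OF fM] by blast
  \<comment> \<open>The cut goes through the square of the last entry \<open>y\<close> outside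
    \<open>M\<close>. The entries after it are top in the quotient, so the part ending in the first
    copy of \<open>y\<close> is already null, while the second copy keeps the rest outside
    \<open>M\<close>.\<close>
  then obtain us y vs where ys: "ys = us @ y # vs" "y \<notin> M" "\<forall>v\<in>set vs. v \<in> M"
    using split_list_last_prop[of ys "\<lambda>y. y \<notin> M"] by blast
  let ?sq = "\<lambda>xs. prod_list (map (\<lambda>x. x ^ 2) xs)"
  have one_vs: "1 \<preceq> prod_list vs"
    using ys(3) pbl_filter_prod_list_iff[OF fM] one_le_iff_mem by blast
  have "?sq us * y \<preceq> prod_list us * y * 1"
    by (simp add: leI mult_right_mono_pbl prod_list_squares_le)
  also have "\<dots> \<preceq> prod_list us * y * prod_list vs"
    by (rule le_mult_mono[OF leI[OF order_refl] one_vs])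
  also have "\<dots> \<preceq> 0" using null by (simp add: ys mult.assoc)
  finally have "?sq us * y \<preceq> 0" .
  moreover have "y * ?sq vs \<notin> M"
    using ys(2) pbl_filter_mult_iff[OF fM] by blast
  moreover have "?sq ys \<le> ?sq us * y * (y * ?sq vs)"
    by (simp add: ys power2_eq_square mult.assoc)
  ultimately show "\<exists>p q. ?sq ys \<le> p * q \<and> p \<preceq> 0 \<and> q \<notin> M" by blast
qed

text \<open>The doubled exponent leaves two equal factors \<open>y ^ n\<close>; in the null case
  they serve as \<open>p\<close> and \<open>q\<close>.\<close>

lemma split_power:
  assumes "x \<preceq> y" "y \<preceq> x"
  shows "\<exists>p q. ((x ^ n)\<^sup>-) ^ 2 * y ^ (2 * n) \<le> p * q \<and> q\<^sup>- \<^bold>\<rightarrow> p \<notin> M"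
proof (rule split_neg1_square)
  have eq: "y ^ (2 * n) = y ^ n * y ^ n" by (simp add: mult_2 power_add)
  have "y ^ n \<preceq> x ^ n" using assms le_power_mono by blast
  then show "y ^ (2 * n) \<preceq> x ^ n"
    using leI[OF mult_le_left] le_trans eq by metis
  assume "x ^ n \<preceq> 0"
  then have "y ^ n \<preceq> 0" using \<open>y ^ n \<preceq> x ^ n\<close> le_trans by blast
  moreover from this have "y ^ n \<notin> M"
    using one_le_iff_mem zero_notin le_trans by blast
  ultimately show "\<exists>p q. y ^ (2 * n) \<le> p * q \<and> p \<preceq> 0 \<and> q \<notin> M"
    using eq by (metis order_refl)
qed

end

section \<open>Normality from the inequalities\<close>

lemma maximal_filter_ex_null_product:
  fixes M :: "'a::pseudo_bl set"
  assumes M: "maximal_filter M" and x: "x \<notin> M"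
  obtains ws where "set ws \<subseteq> insert x M" "prod_list ws \<le> 0"
proof -
  \<comment> \<open>The filter generated by \<open>M\<close> and \<open>x\<close>, described by
    words because the factors cannot yet be reordered.\<close>
  let ?G = "{z. \<exists>ws. set ws \<subseteq> insert x M \<and> prod_list ws \<le> z}"
  have gen: "z \<in> ?G" if "z \<in> insert x M" for z
    using that by (auto intro!: exI[of _ "[z]"])
  have "z * w \<in> ?G" if "z \<in> ?G" "w \<in> ?G" for z w
  proof -
    from that obtain us vs where "set us \<subseteq> insert x M" "prod_list us \<le> z"
      "set vs \<subseteq> insert x M" "prod_list vs \<le> w" by blast
    then have "set (us @ vs) \<subseteq> insert x M" "prod_list (us @ vs) \<le> z * w"
      by (simp_all add: mult_mono_pbl)
    then show ?thesis by blast
  qed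
  moreover have "w \<in> ?G" if "z \<in> ?G" "z \<le> w" for z w
    using that order_trans by blast
  moreover have "?G \<noteq> {}" using gen by blast
  ultimately have "pbl_filter ?G" unfolding pbl_filter_def by blast
  moreover have "M \<subset> ?G" using gen x by blast
  ultimately have "0 \<in> ?G"
    using M unfolding maximal_filter_iff maximal_avoiding_def by blast
  then show thesis using that by blast
qed

lemma maximal_filter_power_neg1:
  fixes M :: "'a::pseudo_bl set"
  assumes perm: "\<And>xs ys :: 'a list. xs \<noteq> [] \<Longrightarrow> mset xs = mset ys \<Longrightarrow>
      ((prod_list xs)\<^sup>-) ^ 2 \<le> (prod_list (map (\<lambda>x. x ^ 2) ys))\<^sup>-"
    and M: "maximal_filter M" and x: "x \<notin> M"
  shows "\<exists>n\<ge>1. (x ^ n)\<^sup>- \<in> M"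
proof -
  have fM: "pbl_filter M"
    using M by (simp add: maximal_filter_def proper_filter_def)
  obtain ws where ws: "set ws \<subseteq> insert x M" "prod_list ws \<le> 0"
    using maximal_filter_ex_null_product[OF M x] .
  \<comment> \<open>Prepending \<open>x\<close> keeps the product null and makes both the list
    non-empty and \<open>?k\<close> positive. The word is then sorted, with members of
    \<open>M\<close> first.\<close>
  let ?us = "filter (\<lambda>w. w \<in> M) (x # ws)" and ?k = "length (filter (\<lambda>w. w \<notin> M) (x # ws))"
  have "filter (\<lambda>w. w \<notin> M) (x # ws) = replicate ?k x"
    using ws(1) by (intro replicate_eqI refl) (auto split: if_splits)
  then have "mset (x # ws) = mset (?us @ replicate ?k x)"
    by (metis mset_append mset_filter multiset_partition)
  then have "((prod_list (x # ws))\<^sup>-) ^ 2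
      \<le> (prod_list (map (\<lambda>x. x ^ 2) (?us @ replicate ?k x)))\<^sup>-"
    by (intro perm) auto
  moreover have "prod_list (x # ws) \<le> 0"
    using ws(2) mult_le_right order_trans by (metis prod_list.Cons)
  then have "(prod_list (x # ws))\<^sup>- = 1"
    by (simp add: neg1_def imp1_eq_one_iff)
  ultimately have "prod_list (map (\<lambda>x. x ^ 2) ?us) * (x ^ 2) ^ ?k \<le> 0"
    by (simp add: le_neg1_iff map_replicate_const prod_list_replicate)
  then have "prod_list (map (\<lambda>x. x ^ 2) ?us) \<le> (x ^ (2 * ?k))\<^sup>-"
    by (simp add: le_neg1_iff power_mult)
  moreover have "prod_list (map (\<lambda>x. x ^ 2) ?us) \<in> M"
    using pbl_filter_power[OF fM] by (auto simp: pbl_filter_prod_list_iff[OF fM])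
  moreover have "2 * ?k \<ge> 1" using x by simp
  ultimately show ?thesis using pbl_filter_up[OF fM] by blast
qed

text \<open>If \<open>x\<close> were outside \<open>M\<close>, the bound would carry a negated power
  of \<open>x\<close> in \<open>M\<close> to a negated power of \<open>y\<close>, whose product with
  that power of \<open>y\<close> is \<open>0\<close>.\<close>

lemma mem_of_power_neg1_bound:
  fixes M :: "'a::pseudo_bl set"
  assumes M: "maximal_filter M"
    and pow: "x \<notin> M \<Longrightarrow> \<exists>n\<ge>1. (x ^ n)\<^sup>- \<in> M"
    and bound: "\<And>n. n \<ge> 1 \<Longrightarrow> ((x ^ n)\<^sup>-) ^ 2 \<le> (y ^ (2 * n))\<^sup>-"
    and y: "y \<in> M"
  shows "x \<in> M"
proof (rule ccontr)
  have fM: "pbl_filter M" "0 \<notin> M"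
    using M by (simp_all add: maximal_filter_def proper_filter_iff)
  assume "x \<notin> M"
  then obtain n where n: "n \<ge> 1" "(x ^ n)\<^sup>- \<in> M" using pow by blast
  then have "(y ^ (2 * n))\<^sup>- \<in> M"
    using bound pbl_filter_power pbl_filter_up fM(1) by blast
  then have "(y ^ (2 * n))\<^sup>- * y ^ (2 * n) \<in> M"
    using pbl_filter_power pbl_filter_mult fM(1) y by blast
  then show False using neg1_mult_self pbl_filter_up fM by blast
qed

section \<open>Permuted index families and rearranged lists\<close>

lemma permuted_lists_iff:
  fixes R :: "'a list \<Rightarrow> 'a list \<Rightarrow> bool"
  shows "(\<forall>n \<pi> x. n \<ge> 1 \<and> \<pi> permutes {1..n} \<longrightarrow>
      R (map x [1..<Suc n]) (map (\<lambda>i. x (\<pi> i)) [1..<Suc n])) \<longleftrightarrow>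
    (\<forall>xs ys. xs \<noteq> [] \<and> mset xs = mset ys \<longrightarrow> R xs ys)" (is "?L \<longleftrightarrow> ?R")
proof
  assume R: ?R
  show ?L
  proof (intro allI impI, elim conjE)
    fix n :: nat and \<pi> and x :: "nat \<Rightarrow> 'a"
    assume n: "n \<ge> 1" and p: "\<pi> permutes {1..n}"
    have "image_mset \<pi> (mset_set {1..n}) = mset_set {1..n}"
      using p by (simp add: image_mset_mset_set permutes_inj_on permutes_image)
    then have "mset (map x [1..<Suc n]) = mset (map (x \<circ> \<pi>) [1..<Suc n])"
      by (metis atLeastLessThanSuc_atLeastAtMost mset_map mset_upt multiset.map_comp)
    then show "R (map x [1..<Suc n]) (map (\<lambda>i. x (\<pi> i)) [1..<Suc n])"
      using R n by (simp add: comp_def)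
  qed
next
  assume L: ?L
  show ?R
  proof (intro allI impI, elim conjE)
    fix xs ys :: "'a list"
    assume ne: "xs \<noteq> []" and "mset xs = mset ys"
    then obtain p where p: "p permutes {..<length xs}" "permute_list p xs = ys"
      by (metis mset_eq_permutation)
    \<comment> \<open>List positions start at 0 and the index set at 1, so \<open>p\<close> is
      conjugated by the successor, with 0 fixed.\<close>
    define \<pi> where "\<pi> = (\<lambda>i. case i of 0 \<Rightarrow> 0 | Suc j \<Rightarrow> Suc (p j))"
    have "bij_betw \<pi> {1..length xs} {1..length xs}"
    proof -
      have "bij_betw (Suc \<circ> (p \<circ> (\<lambda>i. i - 1))) {1..length xs} {1..length xs}"
      proof (intro bij_betw_trans)
        show "bij_betw (\<lambda>i. i - 1) {1..length xs} {..<length xs}"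
          by (rule bij_betw_byWitness[of _ Suc]) auto
        show "bij_betw p {..<length xs} {..<length xs}"
          using p(1) by (rule permutes_imp_bij)
        show "bij_betw Suc {..<length xs} {1..length xs}"
          by (rule bij_betw_byWitness[of _ "\<lambda>i. i - 1"]) auto
      qed
      then show ?thesis
        by (rule bij_betw_cong[THEN iffD1, rotated]) (auto simp: \<pi>_def split: nat.split)
    qed
    moreover have "\<pi> i = i" if "i \<notin> {1..length xs}" for i
      using that permutes_not_in[OF p(1)] by (auto simp: \<pi>_def split: nat.split)
    ultimately have "\<pi> permutes {1..length xs}" by (rule bij_imp_permutes)
    moreover have "length xs \<ge> 1" using ne by (simp add: Suc_le_eq)
    ultimately have "R (map (\<lambda>i. xs ! (i - 1)) [1..<Suc (length xs)])
        (map (\<lambda>i. xs ! (\<pi> i - 1)) [1..<Suc (length xs)])"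
      using L by blast
    moreover have "map (\<lambda>i. xs ! (i - 1)) [1..<Suc (length xs)] = xs"
      by (rule nth_equalityI) (simp_all del: upt_Suc)
    moreover have "map (\<lambda>i. xs ! (\<pi> i - 1)) [1..<Suc (length xs)] = ys"
      using p(2) by (auto intro!: nth_equalityI simp: \<pi>_def permute_list_def simp del: upt_Suc)
    ultimately show "R xs ys" by simp
  qed
qed

theorem corollary3p4:
  assumes nontrivial: "\<not> trivial_pbl TYPE('a::pseudo_bl)"
  shows "MNPBL TYPE('a) \<longleftrightarrow>
    (\<forall>(n::nat) (\<pi>::nat \<Rightarrow> nat) (x::nat \<Rightarrow> 'a). n \<ge> 1 \<and> \<pi> permutes {1..n} \<longrightarrow>
        ((prod_list (map x [1..<Suc n]))\<^sup>-) ^ 2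
          \<le> (prod_list (map (\<lambda>i. x (\<pi> i) ^ 2) [1..<Suc n]))\<^sup>-) \<and>
    (\<forall>(n::nat) (x::'a) y. n \<ge> 1 \<longrightarrow>
        (((x \<^bold>\<rightarrow> y) ^ n)\<^sup>-) ^ 2 \<le> ((x \<^bold>\<leadsto> y) ^ (2 * n))\<^sup>-) \<and>
    (\<forall>(n::nat) (x::'a) y. n \<ge> 1 \<longrightarrow>
        (((x \<^bold>\<leadsto> y) ^ n)\<^sup>-) ^ 2 \<le> ((x \<^bold>\<rightarrow> y) ^ (2 * n))\<^sup>-)"
    (is "_ \<longleftrightarrow> ?i \<and> ?ii \<and> ?iii")
proof -
  let ?perm = "\<forall>xs ys :: 'a list. xs \<noteq> [] \<and> mset xs = mset ys \<longrightarrow>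
    ((prod_list xs)\<^sup>-) ^ 2 \<le> (prod_list (map (\<lambda>x. x ^ 2) ys))\<^sup>-"
  have i_iff: "?i \<longleftrightarrow> ?perm"
    using permuted_lists_iff[of "\<lambda>xs ys. ((prod_list xs)\<^sup>-) ^ 2
      \<le> (prod_list (map (\<lambda>x::'a. x ^ 2) ys))\<^sup>-"]
    by (simp add: comp_def del: upt_Suc)
  have "(\<forall>M :: 'a set. maximal_filter M \<longrightarrow> normal_filter M) \<longleftrightarrow> ?perm \<and> ?ii \<and> ?iii"
  proof (intro iffI conjI)
    assume "\<forall>M :: 'a set. maximal_filter M \<longrightarrow> normal_filter M"
    then have loc: "normal_maximal M" if "maximal_filter M" for M :: "'a set"
      using that by unfold_locales blast+
    show ?perm
      \<comment> \<open>This puts the inequality into the form \<open>c \<le> 0\<close>, which can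
        be tested at each maximal filter.\<close>
      unfolding le_neg1_iff
      by (intro allI impI eq_zero_by_maximal_filters, elim conjE)
        (rule normal_maximal.split_permuted_product[OF loc])
    show ?ii
      unfolding le_neg1_iff
      by (intro allI impI eq_zero_by_maximal_filters normal_maximal.split_power
          normal_maximal.imp1_le_imp2 normal_maximal.imp2_le_imp1 loc)
    show ?iii
      unfolding le_neg1_iff
      by (intro allI impI eq_zero_by_maximal_filters normal_maximal.split_power
          normal_maximal.imp1_le_imp2 normal_maximal.imp2_le_imp1 loc)
  next
    assume ineqs: "?perm \<and> ?ii \<and> ?iii"
    show "\<forall>M :: 'a set. maximal_filter M \<longrightarrow> normal_filter M"
    proof (intro allI impI)
      fix M :: "'a set"
      assume M: "maximal_filter M"
      have pow: "\<exists>n\<ge>1. (x ^ n)\<^sup>- \<in> M" if "x \<notin> M" for x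
        using maximal_filter_power_neg1[OF _ M that] ineqs by blast
      have "x \<^bold>\<rightarrow> y \<in> M \<longleftrightarrow> x \<^bold>\<leadsto> y \<in> M" for x y
        \<comment> \<open>\<open>?ii\<close> carries membership from the right residual to the left
          one, and \<open>?iii\<close> carries it back.\<close>
        using mem_of_power_neg1_bound[OF M pow] ineqs by blast
      then show "normal_filter M"
        using M by (simp add: normal_filter_def maximal_filter_def proper_filter_def)
    qed
  qed
  then show ?thesis
    unfolding i_iff MNPBL_def using nontrivial by blast
qed

end
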